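(* Let $X$ be a Kadec normed space and let $A\subset X\setminus\{0_X\}$. Then the following assertions are equivalent: (i) $A$ is directionally compact; (ii) $A$ is directionally weakly compact.
   Context: $X$ is a real normed space with unit sphere $S_X$. $X$ is Kadec if the weak topology $\sigma(X,X^* )$ and the norm topology coincide on $S_X$. For $A\subset X\setminus\{0_X\}$, $\Pi_{S_X}(A):=\{a/\|a\|:a\in A\}$; $A$ is directionally compact (resp. directionally weakly compact) if $\Pi_{S_X}(A)$ is norm compact (resp. weakly compact). *)

theory Defs
  imports "HOL-Analysis.Analysis"
begin

text \<open>The weak topology \<open>\<sigma>(X, X\<^sup>*)\<close>: the coarsest topology on \<open>X\<close> making every element of the
  topological dual \<open>X\<^sup>*\<close> (the type of bounded linear functionals) continuous.\<close>

definition weak_topology :: "'a::real_normed_vector topology" where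
  "weak_topology =
     topology_generated_by {blinfun_apply f -` U | (f :: 'a \<Rightarrow>\<^sub>L real) U. open U}"

lemma topspace_weak_topology [simp]: "topspace (weak_topology :: 'a::real_normed_vector topology) = UNIV"
proof -
  have "blinfun_apply (0 :: 'a \<Rightarrow>\<^sub>L real) -` UNIV
      \<in> {blinfun_apply f -` U | (f :: 'a \<Rightarrow>\<^sub>L real) U. open U}"
    using open_UNIV by blast
  then show ?thesis
    unfolding weak_topology_def topology_generated_by_topspace by auto
qed

definition kadec_space :: "'a::real_normed_vector itself \<Rightarrow> bool" where
  "kadec_space (X :: 'a itself) \<longleftrightarrow>
     subtopology weak_topology (sphere (0::'a) 1) = subtopology euclidean (sphere (0::'a) 1)"

text \<open>Only meaningful for sets not containing \<open>0\<close>, since \<open>a /\<^sub>R norm a = 0\<close> for \<open>a = 0\<close>.\<close>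

definition sphere_proj :: "'a::real_normed_vector set \<Rightarrow> 'a set" where
  "sphere_proj A = {a /\<^sub>R norm a | a. a \<in> A}"

definition directionally_compact :: "'a::real_normed_vector set \<Rightarrow> bool" where
  "directionally_compact A \<longleftrightarrow> compact (sphere_proj A)"

definition directionally_weakly_compact :: "'a::real_normed_vector set \<Rightarrow> bool" where
  "directionally_weakly_compact A \<longleftrightarrow> compactin weak_topology (sphere_proj A)"

end

theory Submission
  imports Defs
begin

text \<open>Compactness of a set depends only on the topology it inherits, so it may be tested
  inside any subspace containing the set (\<open>compactin_subtopology\<close>). The projection of
  \<open>A\<close> lies in the unit sphere, where the Kadec property identifies the norm and weak
  topologies.\<close>

lemma sphere_proj_subset_sphere:
  fixes A :: "'a::real_normed_vector set"
  assumes "0 \<notin> A"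
  shows "sphere_proj A \<subseteq> sphere 0 1"
  \<comment> \<open>Since \<open>0\<close> is not in \<open>A\<close>, each \<open>norm a\<close> is
    invertible; the vector \<open>0\<close> itself would be sent to \<open>0\<close>, off the
    sphere.\<close>
  using assms by (auto simp: sphere_proj_def intro!: left_inverse)

theorem corollary3p10:
  fixes A :: "'a::real_normed_vector set"
  assumes "kadec_space TYPE('a)"
    and "A \<subseteq> UNIV - {0}"
  shows "directionally_compact A \<longleftrightarrow> directionally_weakly_compact A"
proof -
  have sub: "sphere_proj A \<subseteq> sphere 0 1"
    using assms(2) by (intro sphere_proj_subset_sphere) auto
  have "compact (sphere_proj A)
      \<longleftrightarrow> compactin (subtopology euclidean (sphere 0 1)) (sphere_proj A)"
    using sub by (simp add: compactin_subtopology)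
  \<comment> \<open>The Kadec property is an equality of topologies on the sphere, so one replaces
    the other.\<close>
  also have "\<dots> \<longleftrightarrow> compactin (subtopology weak_topology (sphere 0 1)) (sphere_proj A)"
    using assms(1) by (simp add: kadec_space_def)
  also have "\<dots> \<longleftrightarrow> compactin weak_topology (sphere_proj A)"
    using sub by (simp add: compactin_subtopology)
  finally show ?thesis
    by (simp add: directionally_compact_def directionally_weakly_compact_def)
qed

end
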